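(* For positive integers $k\le n$, $$ s(k,n)\le n+k^2\left(\frac14-\frac1{(\pi+2)^2}+o(1)\right),$$ where $o(1)$ denotes a quantity tending to $0$ as $n\to\infty$.
   Context: $[n]=\{1,\dots,n\}$. For a set $A$ of integers, $A+A=\{a+b: a,b\in A\}$. Define $s(k,n)=\max\{|A+A| : A\subseteq[n],\ |A|=k\}$. *)

theory Defs
  imports Complex_Main
begin

definition sumset :: "int set \<Rightarrow> int set" where
  "sumset A = {a + b | a b. a \<in> A \<and> b \<in> A}"

definition s :: "nat \<Rightarrow> nat \<Rightarrow> nat" where
  "s k n = Max {card (sumset A) | A. A \<subseteq> {1..int n} \<and> card A = k}"

end

theory Submission
  imports Defs
begin

text \<open>
  Translate A to a subset B of {0,...,n-1} and let F z be the sum of z^a over a in B. If z is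
  a root of unity of order dividing 2n-1 and z is not 1, then the powers z^m with m < 2n-1 sum to
  zero, so F(z)^2 + F(z^2) equals the sum of (w m - 2) z^m, where w m counts ordered
  representations of m plus diagonal ones. As w m is at least 2 on the sumset and 0 off it, a large
  sumset forces F(z) to be small for all such z.

  On the other hand all angles 2 pi a / (2n-1) lie in [0, pi], where the truncated Fourier
  series of |sin| gives, for large M,
    sin x + (4/pi) * (sum for 1 <= m <= M of cos (2 m x) / (4 m^2 - 1)) >= 2/pi - o(1).
  Summing over B, the coefficients having total mass at most 1 + 2/pi, some F(z) has modulus at
  least (2/(pi+2) - o(1)) k. If k(k+1) <= 2n the theorem is trivial; otherwise k >= sqrt n, which
  absorbs the terms linear in k.
\<close>

section \<open>Large sumsets force small power sums at roots of unity\<close>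

lemma norm_power_sum_root_of_unity_le:
  fixes B :: "nat set" and z :: complex
  assumes B: "B \<subseteq> {..<n}" and n: "n \<ge> 1"
    and z: "z ^ (2*n - 1) = 1" "z \<noteq> 1" "norm z = 1"
  shows "norm ((\<Sum>a\<in>B. z ^ a)\<^sup>2 + (\<Sum>a\<in>B. z ^ (2*a)))
    \<le> (real (card B))\<^sup>2 + real (card B) + 2 * (2 * real n - 1)
      - 4 * real (card ((\<lambda>(a,b). a + b) ` (B \<times> B)))"
proof -
  define S where "S = (\<lambda>(a,b). a + b) ` (B \<times> B)"
  \<comment> \<open>Sums of two elements of \<open>B\<close> are at most 2n - 2, so the exponents
    below \<open>N\<close> cover the whole sumset.\<close>
  define N where "N = 2*n - 1"
  have fin: "finite B" using B finite_subset by blast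
  have ab: "a + b < N" if "a \<in> B" "b \<in> B" for a b
  proof -
    have "a < n" "b < n" using that B by auto
    then show ?thesis by (simp add: N_def)
  qed
  have SN: "S \<subseteq> {..<N}" by (auto simp: S_def ab)
  \<comment> \<open>The second summand counts the diagonal once more, so that even a sum whose only
    representation is \<open>a + a\<close> gets weight at least 2.\<close>
  define w where "w m = card {p \<in> B \<times> B. fst p + snd p = m} + card {a \<in> B. 2*a = m}" for m
  have group: "(\<Sum>m<N. of_nat (w m) * g m)
      = (\<Sum>(a,b)\<in>B\<times>B. g (a + b)) + (\<Sum>a\<in>B. g (2*a))" for g :: "nat \<Rightarrow> 'b::comm_semiring_1"
  proof -
    have "(\<Sum>m<N. \<Sum>p\<in>{p\<in>B\<times>B. fst p + snd p = m}. g (fst p + snd p))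
        = (\<Sum>p\<in>B\<times>B. g (fst p + snd p))"
      using fin ab by (subst sum.group[symmetric, where T = "{..<N}" and g = "\<lambda>p. fst p + snd p"])
        (auto intro!: sum.cong)
    moreover have "(\<Sum>m<N. \<Sum>a\<in>{a\<in>B. 2*a = m}. g (2*a)) = (\<Sum>a\<in>B. g (2*a))"
      using fin ab[of a a for a] by (subst sum.group[symmetric, where T = "{..<N}" and g = "\<lambda>a. 2*a"])
        (auto intro!: sum.cong simp: mult_2)
    ultimately show ?thesis
      by (simp add: w_def distrib_right sum.distrib case_prod_beta)
  qed
  have w2: "w m \<ge> 2" if mS: "m \<in> S" for m
  proof -
    obtain a b where ab: "a \<in> B" "b \<in> B" "m = a + b" using mS by (auto simp: S_def)
    show ?thesis
    proof (cases "a = b")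
      case True
      have "card {(a,b)} \<le> card {p \<in> B \<times> B. fst p + snd p = m}"
        using ab fin by (intro card_mono) auto
      moreover have "card {a} \<le> card {a \<in> B. 2*a = m}"
        using ab fin True by (intro card_mono) auto
      ultimately show ?thesis by (simp add: w_def)
    next
      case False
      have "card {(a,b), (b,a)} \<le> card {p \<in> B \<times> B. fst p + snd p = m}"
        using ab fin by (intro card_mono) auto
      with False show ?thesis by (simp add: w_def)
    qed
  qed
  have "a + b \<in> S" if "a \<in> B" "b \<in> B" for a b using that by (auto simp: S_def)
  then have w0: "w m = 0" if "m \<notin> S" for m
    using that by (auto simp: w_def fin mult_2)
  have geo: "(\<Sum>m<N. z ^ m) = 0"
    using z by (simp add: geometric_sum N_def)
  have "(\<Sum>a\<in>B. z ^ a)\<^sup>2 = (\<Sum>(a,b)\<in>B\<times>B. z ^ (a + b))"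
    by (simp add: power2_eq_square sum_product sum.cartesian_product power_add)
  then have "(\<Sum>a\<in>B. z ^ a)\<^sup>2 + (\<Sum>a\<in>B. z ^ (2*a)) = (\<Sum>m<N. of_nat (w m) * z ^ m)"
    by (simp only: group[of "\<lambda>m. z ^ m"])
  \<comment> \<open>Subtracting twice the vanishing geometric sum changes nothing, but it lowers the
    weights before the triangle inequality is applied.\<close>
  also have "\<dots> = (\<Sum>m<N. of_real (real (w m) - 2) * z ^ m)"
    using geo by (simp add: left_diff_distrib sum_subtractf flip: sum_distrib_left)
  also have "norm \<dots> \<le> (\<Sum>m<N. \<bar>real (w m) - 2\<bar>)"
    by (rule order.trans[OF norm_sum])
       (simp only: norm_mult norm_power z norm_of_real power_one mult_1_right order.refl)
  \<comment> \<open>On \<open>S\<close> the absolute value is \<open>w m - 2\<close>; off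
    \<open>S\<close> it is 2, which equals \<open>w m + 2\<close> there.\<close>
  also have "\<dots> = (\<Sum>m<N. real (w m) + 2 - 4 * (if m \<in> S then 1 else 0))"
    by (intro sum.cong) (use w2 w0 in force)+
  also have "\<dots> = (\<Sum>m<N. real (w m)) + 2 * real N - 4 * real (card S)"
    using SN
    by (simp add: sum.distrib sum_subtractf Int_absorb1 sum.If_cases flip: sum_distrib_left)
  also have "(\<Sum>m<N. real (w m)) = (real (card B))\<^sup>2 + real (card B)"
    using group[of "\<lambda>_. 1::real"] by (simp add: power2_eq_square card_cartesian_product)
  finally show ?thesis using n by (simp add: S_def N_def of_nat_diff)
qed

section \<open>Partial sums of the square wave and the Fourier series of |sin|\<close>

text \<open>Partial sums of the Fourier series of the square wave, whose value on (0, pi) is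
  pi/4.\<close>

definition odd_sine_sum :: "nat \<Rightarrow> real \<Rightarrow> real" where
  "odd_sine_sum M x = (\<Sum>m<M. sin (real (2*m+1) * x) / real (2*m+1))"

text \<open>The products sin x sin((2m+1)x) are differences of cosines, and summation by parts gives
  the identity. As (2m+1)(2m+3) = 4(m+1)^2 - 1, the left side is the cosine part of the series of
  |sin|, so bounding it from below amounts to bounding sin x times the sine sum from above.\<close>

lemma sum_cos_over_product:
  "(\<Sum>m<M. cos (real (2*(m+1)) * x) / real ((2*m+1)*(2*m+3)))
    = 1/2 - sin x * odd_sine_sum M x - cos (real (2*M) * x) / (2 * real (2*M+1))"
proof (induction M)
  case (Suc M)
  have "2 * (sin (real (2*M+1) * x) * sin x) = cos (real (2*M+1) * x - x) - cos (real (2*M+1) * x + x)"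
    by (simp add: cos_add cos_diff)
  also have "real (2*M+1) * x - x = real (2*M) * x" by (simp add: algebra_simps)
  also have "real (2*M+1) * x + x = real (2*(M+1)) * x" by (simp add: algebra_simps)
  finally have *: "sin x * sin (real (2*M+1) * x)
      = (cos (real (2*M) * x) - cos (real (2*(M+1)) * x)) / 2" by (simp add: mult.commute)
  have **: "1 / real ((2*M+1)*(2*M+3)) = 1 / (2 * real (2*M+1)) - 1 / (2 * real (2*M+3))"
    by (simp add: divide_simps del: of_nat_add of_nat_mult) (simp add: algebra_simps)
  have frac: "c / real ((2*M+1)*(2*M+3)) = c / (2 * real (2*M+1)) - c / (2 * real (2*M+3))" for c :: real
    using arg_cong[OF **, of "(*) c"] by (simp add: algebra_simps)
  have "sin x * odd_sine_sum (Suc M) x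
      = sin x * odd_sine_sum M x + sin x * sin (real (2*M+1) * x) / real (2*M+1)"
    by (simp add: odd_sine_sum_def algebra_simps)
  then show ?case
    unfolding sum.lessThan_Suc Suc.IH * frac by (simp add: diff_divide_distrib add_divide_distrib)
qed (simp add: odd_sine_sum_def)

text \<open>Telescoping; the cosine sum is the derivative of \<open>odd_sine_sum M\<close>.\<close>

lemma sum_cos_odd: "2 * sin x * (\<Sum>m<M. cos (real (2*m+1) * x)) = sin (real (2*M) * x)"
proof (induction M)
  case (Suc M)
  have "real (2*Suc M) * x = real (2*M+1) * x + x" "real (2*M) * x = real (2*M+1) * x - x"
    by (simp_all add: algebra_simps)
  then have "sin (real (2*Suc M) * x) = sin (real (2*M) * x) + 2 * sin x * cos (real (2*M+1) * x)"
    by (simp only: sin_add sin_diff) (simp add: algebra_simps)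
  with Suc show ?case by (simp add: algebra_simps)
qed simp

text \<open>Near 0 the sine sum alone overshoots pi/4 (Gibbs phenomenon). The factor sin x cancels
  the singular denominator of the correction in \<open>H\<close>, and only an excess of order 1/M
  survives.\<close>

lemma odd_sine_sum_le_aux:
  assumes M: "M \<ge> 1" and x: "0 < x" "x \<le> pi/2"
  shows "sin x * odd_sine_sum M x \<le> sin x * odd_sine_sum M (pi/2) + 1 / (2 * real M)"
proof -
  \<comment> \<open>The correction term is chosen so that the derivative of H is nonnegative: it cancels the
    oscillating derivative of the sine sum up to an error dominated by that of 1/(4 M sin t).\<close>
  define H where "H t = odd_sine_sum M t - (1 - cos (real (2*M) * t)) / (4 * real M * sin t)" for t
  have "H x \<le> H (pi/2)"
  proof (rule DERIV_nonneg_imp_nondecreasing[OF x(2)])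
    fix t assume t: "x \<le> t" "t \<le> pi/2"
    have s: "sin t > 0" using t x by (intro sin_gt_zero) auto
    have c: "cos t \<ge> 0" using t x by (intro cos_ge_zero) auto
    let ?H' = "cos t * (1 - cos (real (2*M) * t)) / (4 * real M * (sin t)\<^sup>2)"
    have "(odd_sine_sum M has_real_derivative (\<Sum>m<M. cos (real (2*m+1) * t))) (at t)"
      unfolding odd_sine_sum_def
      by (auto intro!: derivative_eq_intros sum.cong simp del: of_nat_add of_nat_mult)
    moreover have "(\<Sum>m<M. cos (real (2*m+1) * t)) = sin (real (2*M) * t) / (2 * sin t)"
      using sum_cos_odd[of t M] s by (simp add: field_simps)
    ultimately have "(odd_sine_sum M has_real_derivative sin (real (2*M) * t) / (2 * sin t)) (at t)"
      by simp
    then have "(H has_real_derivative ?H') (at t)"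
      unfolding H_def using s M
      by (auto intro!: derivative_eq_intros simp: field_simps power2_eq_square)
    moreover have "?H' \<ge> 0" using c by (intro divide_nonneg_nonneg mult_nonneg_nonneg) auto
    ultimately show "\<exists>y. (H has_real_derivative y) (at t) \<and> 0 \<le> y" by blast
  qed
  moreover have "H (pi/2) \<le> odd_sine_sum M (pi/2)"
    using cos_le_one[of "real (2*M) * (pi/2)"] by (simp add: H_def del: cos_le_one)
  ultimately have le: "odd_sine_sum M x \<le>
      odd_sine_sum M (pi/2) + (1 - cos (real (2*M) * x)) / (4 * real M * sin x)"
    by (simp add: H_def)
  have s: "sin x > 0" using x by (intro sin_gt_zero) auto
  have "sin x * odd_sine_sum M x \<le>
      sin x * (odd_sine_sum M (pi/2) + (1 - cos (real (2*M) * x)) / (4 * real M * sin x))"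
    using s le by (intro mult_left_mono) auto
  also have "\<dots> = sin x * odd_sine_sum M (pi/2) + (1 - cos (real (2*M) * x)) / (4 * real M)"
    using s M by (simp add: field_simps)
  also have "\<dots> \<le> sin x * odd_sine_sum M (pi/2) + 2 / (4 * real M)"
    using cos_ge_minus_one[of "real (2*M) * x"] by (intro add_left_mono divide_right_mono) auto
  finally show ?thesis by simp
qed

lemma odd_sine_sum_reflect: "odd_sine_sum M (pi - x) = odd_sine_sum M x"
proof -
  have "sin (real (2*m+1) * (pi - x)) = sin (real (2*m+1) * x)" for m
  proof -
    have "real (2*m+1) * (pi - x) = (pi - real (2*m+1) * x) + 2 * real m * pi"
      by (simp add: algebra_simps)
    then show ?thesis
      by (simp only: sin_add sin_2npi cos_2npi) (simp only: sin_pi_minus mult_1_right mult_zero_right add_0_right)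
  qed
  then show ?thesis by (simp add: odd_sine_sum_def)
qed

lemma odd_sine_sum_le:
  assumes M: "M \<ge> 1" and x: "0 \<le> x" "x \<le> pi"
  shows "sin x * odd_sine_sum M x \<le> sin x * odd_sine_sum M (pi/2) + 1 / (2 * real M)"
proof -
  consider "sin x = 0" | "0 < x" "x \<le> pi/2" | "0 < pi - x" "pi - x \<le> pi/2"
    using x by (cases "x = 0 \<or> x = pi") (force, linarith)
  then show ?thesis
  proof cases
    case 2 then show ?thesis by (rule odd_sine_sum_le_aux[OF M])
  next
    case 3
    from odd_sine_sum_le_aux[OF M this] show ?thesis by (simp add: odd_sine_sum_reflect)
  qed simp
qed

text \<open>At pi/2 the sine sum is a partial sum of the Leibniz series for arctan 1.\<close>

lemma odd_sine_sum_half_pi: "(\<lambda>M. odd_sine_sum M (pi/2)) \<longlonglongrightarrow> pi/4"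
proof -
  have "sin (real (2*m+1) * (pi/2)) = (-1)^m" for m
  proof -
    have "real (2*m+1) * (pi/2) = real m * pi + pi/2" by (simp add: algebra_simps)
    then show ?thesis by (simp only: sin_add) simp
  qed
  then have eq: "odd_sine_sum M (pi/2) = (\<Sum>m<M. (-1)^m * (1 / real (m*2+1) * 1 ^ (m*2+1)))" for M
    by (simp add: odd_sine_sum_def mult.commute)
  have "(\<lambda>m. (-1)^m * (1 / real (m*2+1) * (1::real) ^ (m*2+1))) sums arctan 1"
    using summable_arctan_series[of 1] arctan_series[of 1] by (auto simp: sums_iff)
  then show ?thesis by (simp add: sums_def eq arctan_one)
qed

text \<open>The term 1/M collects two halves: the excess in \<open>odd_sine_sum_le\<close> and the
  last cosine in \<open>sum_cos_over_product\<close>.\<close>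

definition truncation_error :: "nat \<Rightarrow> real" where
  "truncation_error M = \<bar>odd_sine_sum M (pi/2) - pi/4\<bar> + 1 / real M"

lemma truncation_error_tendsto: "truncation_error \<longlonglongrightarrow> 0"
proof -
  have "(\<lambda>M. odd_sine_sum M (pi/2) - pi/4) \<longlonglongrightarrow> 0"
    using tendsto_diff[OF odd_sine_sum_half_pi tendsto_const[of "pi/4"]] by simp
  from tendsto_add[OF tendsto_rabs[OF this] lim_1_over_n] show ?thesis
    unfolding truncation_error_def[abs_def] by simp
qed

text \<open>This is pi/4 times the inequality for the truncated series of |sin|; only this one-sided
  estimate is needed.\<close>

lemma truncated_abs_sine_ge:
  assumes M: "M \<ge> 1" and x: "0 \<le> x" "x \<le> pi"
  shows "1/2 - truncation_error M \<le>
    pi/4 * sin x + (\<Sum>m<M. cos (real (2*(m+1)) * x) / real ((2*m+1)*(2*m+3)))"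
proof -
  have s: "0 \<le> sin x" "sin x \<le> 1" using x by (auto intro: sin_ge_zero)
  have "sin x * (odd_sine_sum M (pi/2) - pi/4) \<le> \<bar>sin x * (odd_sine_sum M (pi/2) - pi/4)\<bar>"
    by (rule abs_ge_self)
  also have "\<dots> \<le> 1 * \<bar>odd_sine_sum M (pi/2) - pi/4\<bar>"
    unfolding abs_mult using s by (intro mult_right_mono) auto
  finally have "sin x * (odd_sine_sum M (pi/2) - pi/4) \<le> \<bar>odd_sine_sum M (pi/2) - pi/4\<bar>"
    by simp
  moreover have "cos (real (2*M) * x) / (2 * real (2*M+1)) \<le> 1 / (2 * real M)"
    using M by (intro frac_le) auto
  moreover have "1 / (2 * real M) + 1 / (2 * real M) = 1 / real M" by simp
  ultimately show ?thesis
    using odd_sine_sum_le[OF M x]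
    unfolding sum_cos_over_product truncation_error_def right_diff_distrib
    by (simp add: mult.commute)
qed

text \<open>The case x = 0 of the cosine identity bounds the total mass of the cosine
  coefficients.\<close>

lemma sum_inverse_odd_product_le: "(\<Sum>m<M. 1 / real ((2*m+1)*(2*m+3))) \<le> 1/2"
  using sum_cos_over_product[of 0 M] by simp

section \<open>Some exponential sum over a half circle is large\<close>

lemma exponential_sum_bound:
  fixes B :: "nat set" and n :: nat
  defines "\<theta> \<equiv> 2 * pi / real (2*n - 1)"
  assumes B: "B \<subseteq> {..<n}" and n: "n \<ge> 2"
    and t: "\<And>j. 1 \<le> j \<Longrightarrow> j < 2*n - 1 \<Longrightarrow> norm (\<Sum>a\<in>B. cis (real j * (real a * \<theta>))) \<le> t"
  shows "real (card B) * (2 - 4 * truncation_error (n - 1)) \<le> (pi + 2) * t"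
proof -
  \<comment> \<open>The largest cutoff that keeps all frequencies 2(m+1), m < M, below 2n - 1, where
    the bound \<open>t\<close> applies.\<close>
  define M where "M = n - 1"
  have M: "M \<ge> 1" using n by (simp add: M_def)
  have t0: "t \<ge> 0" using order.trans[OF norm_ge_zero t[of 1]] n by simp
  \<comment> \<open>Since a < n gives 2a <= 2n - 1, the points lie on the upper half circle, where
    sin agrees with |sin|. Thus the single frequency 1 handles the sine term.\<close>
  have angle: "0 \<le> real a * \<theta>" "real a * \<theta> \<le> pi" if "a \<in> B" for a
  proof -
    have "2 * a \<le> 2*n - 1" using that B by auto
    then have "2 * real a \<le> real (2*n - 1)" by (simp flip: of_nat_le_iff)
    then have "pi * (2 * real a) \<le> pi * real (2*n - 1)" by (intro mult_left_mono) auto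
    then show "real a * \<theta> \<le> pi" using n by (simp add: \<theta>_def field_simps)
  qed (simp add: \<theta>_def)
  have sin_le: "(\<Sum>a\<in>B. sin (real a * \<theta>)) \<le> t"
  proof -
    have "(\<Sum>a\<in>B. sin (real a * \<theta>)) = Im (\<Sum>a\<in>B. cis (real 1 * (real a * \<theta>)))"
      by simp
    also have "\<dots> \<le> t" by (rule order.trans[OF order.trans[OF abs_ge_self abs_Im_le_cmod] t]) (use n in auto)
    finally show ?thesis .
  qed
  have cos_le: "(\<Sum>a\<in>B. cos (real (2*(m+1)) * (real a * \<theta>))) \<le> t" if "m < M" for m
  proof -
    have "(\<Sum>a\<in>B. cos (real (2*(m+1)) * (real a * \<theta>)))
        = Re (\<Sum>a\<in>B. cis (real (2*(m+1)) * (real a * \<theta>)))" by simp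
    also have "\<dots> \<le> t"
      by (rule order.trans[OF complex_Re_le_cmod t]) (use that in \<open>auto simp: M_def\<close>)
    finally show ?thesis .
  qed
  have "real (card B) * (1/2 - truncation_error M) = (\<Sum>a\<in>B. 1/2 - truncation_error M)"
    by simp
  also have "\<dots> \<le> (\<Sum>a\<in>B. pi/4 * sin (real a * \<theta>)
      + (\<Sum>m<M. cos (real (2*(m+1)) * (real a * \<theta>)) / real ((2*m+1)*(2*m+3))))"
    by (intro sum_mono truncated_abs_sine_ge M angle)
  also have "\<dots> = pi/4 * (\<Sum>a\<in>B. sin (real a * \<theta>))
      + (\<Sum>m<M. (\<Sum>a\<in>B. cos (real (2*(m+1)) * (real a * \<theta>))) / real ((2*m+1)*(2*m+3)))"
    unfolding sum.distrib sum_distrib_left sum_divide_distrib by (subst sum.swap) (rule refl)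
  also have "\<dots> \<le> pi/4 * t + (\<Sum>m<M. t / real ((2*m+1)*(2*m+3)))"
    using sin_le cos_le by (intro add_mono mult_left_mono sum_mono divide_right_mono) auto
  also have "(\<Sum>m<M. t / real ((2*m+1)*(2*m+3))) = t * (\<Sum>m<M. 1 / real ((2*m+1)*(2*m+3)))"
    by (simp add: sum_distrib_left)
  also have "\<dots> \<le> t * (1/2)"
    using t0 by (intro mult_left_mono sum_inverse_odd_product_le)
  finally have "4 * (real (card B) * (1/2 - truncation_error M)) \<le> 4 * (pi/4 * t + t * (1/2))"
    by simp
  then show ?thesis by (simp add: M_def algebra_simps)
qed

section \<open>Combining the upper and lower bounds\<close>

lemma card_sums_le:
  fixes B :: "nat set" and n :: nat
  assumes B: "B \<subseteq> {..<n}" and n: "n \<ge> 2"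
  shows "real (card ((\<lambda>(a,b). a + b) ` (B \<times> B)))
    \<le> real n + (real (card B))\<^sup>2 * (1/4 - 1/(pi+2)\<^sup>2 + 4 * truncation_error (n - 1) / (pi+2)\<^sup>2)
      + real (card B) / 2"
proof -
  define \<theta> where "\<theta> = 2 * pi / real (2*n - 1)"
  define k where "k = real (card B)"
  define C where "C = real (card ((\<lambda>(a,b). a + b) ` (B \<times> B)))"
  \<comment> \<open>The bound on |F(z)^2 + F(z^2)| plus a further \<open>k\<close> for removing
    F(z^2).\<close>
  define D where "D = k\<^sup>2 + 2*k + 2 * (2 * real n - 1) - 4 * C"
  define \<eta> where "\<eta> = truncation_error (n - 1)"
  have sq: "(norm (\<Sum>a\<in>B. cis (real j * (real a * \<theta>))))\<^sup>2 \<le> D" if j: "1 \<le> j" "j < 2*n - 1" for j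
  proof -
    define z where "z = cis (real j * \<theta>)"
    have pow: "z ^ a = cis (real j * (real a * \<theta>))" for a
      by (simp add: z_def DeMoivre mult_ac)
    have "z ^ (2*n - 1) = cis (2 * pi * real j)"
      unfolding pow using n by (simp add: \<theta>_def mult_ac del: of_nat_diff)
    then have z1: "z ^ (2*n - 1) = 1" by (simp add: cis_multiple_2pi)
    \<comment> \<open>Otherwise 2n - 1 would divide \<open>j\<close>, although 1 <= j < 2n -
      1.\<close>
    have z2: "z \<noteq> 1"
    proof
      assume "z = 1"
      then have "cos (real j * \<theta>) = 1" by (simp add: z_def complex_eq_iff)
      then obtain i :: int where i: "real j * \<theta> = of_int i * 2 * pi"
        using cos_one_2pi_int by blast
      then have "real j = of_int i * real (2*n - 1)"
        using n by (simp add: \<theta>_def field_simps del: of_nat_diff)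
      then have "int j = i * int (2*n - 1)"
        by (metis of_int_eq_iff of_int_mult of_int_of_nat_eq)
      then have "int (2*n - 1) dvd int j" by simp
      with j show False by (simp only: int_dvd_int_iff) (auto dest: dvd_imp_le)
    qed
    let ?F = "\<Sum>a\<in>B. z ^ a" and ?F2 = "\<Sum>a\<in>B. z ^ (2*a)"
    have nz: "norm z = 1" by (simp add: z_def)
    have "norm ?F2 \<le> k"
      by (rule order.trans[OF norm_sum]) (simp add: norm_power nz k_def)
    moreover have "norm (?F\<^sup>2 + ?F2) \<le> k\<^sup>2 + k + 2 * (2 * real n - 1) - 4 * C"
      unfolding k_def C_def using n by (intro norm_power_sum_root_of_unity_le B z1 z2 nz) auto
    moreover have "norm (?F\<^sup>2) \<le> norm (?F\<^sup>2 + ?F2) + norm ?F2"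
      using norm_triangle_ineq4[of "?F\<^sup>2 + ?F2" ?F2] by simp
    ultimately have "norm (?F\<^sup>2) \<le> D" by (simp add: D_def)
    then show ?thesis by (simp add: norm_power pow)
  qed
  have D0: "D \<ge> 0" using order.trans[OF zero_le_power2 sq[of 1]] n by simp
  have "k * (2 - 4*\<eta>) \<le> (pi + 2) * sqrt D"
    unfolding k_def \<eta>_def using sq
    by (intro exponential_sum_bound B n real_le_rsqrt) (simp add: \<theta>_def)
  \<comment> \<open>Squaring needs a nonnegative left side; dropping 16 \<eta>^2 then leaves an
    error linear in \<eta>. In the other case 4 - 16 \<eta> is negative and the claim is
    trivial.\<close>
  then have "k\<^sup>2 * (4 - 16*\<eta>) \<le> (pi + 2)\<^sup>2 * D"
  proof (cases "2 - 4*\<eta> \<ge> 0")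
    case True
    assume "k * (2 - 4*\<eta>) \<le> (pi + 2) * sqrt D"
    then have "(k * (2 - 4*\<eta>))\<^sup>2 \<le> ((pi + 2) * sqrt D)\<^sup>2"
      using True by (intro power_mono) (auto simp: k_def)
    moreover have "k\<^sup>2 * (4 - 16*\<eta>) \<le> k\<^sup>2 * (2 - 4*\<eta>)\<^sup>2"
      by (intro mult_left_mono) (auto simp: power2_diff)
    ultimately show ?thesis using D0 by (simp add: power_mult_distrib)
  next
    case False
    then have "k\<^sup>2 * (4 - 16*\<eta>) \<le> 0" by (intro mult_nonneg_nonpos) auto
    also have "0 \<le> (pi + 2)\<^sup>2 * D" using D0 by (intro mult_nonneg_nonneg) auto
    finally show ?thesis .
  qed
  then have "k\<^sup>2 * (4 - 16*\<eta>) / (pi + 2)\<^sup>2 \<le> D"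
    using zero_less_power[OF add_pos_pos[OF pi_gt_zero, of 2], of 2]
    by (subst pos_divide_le_eq) (auto simp: mult.commute)
  moreover have "k\<^sup>2 * (4 - 16*\<eta>) / (pi + 2)\<^sup>2 = 4 * (k\<^sup>2 * (1/(pi+2)\<^sup>2 - 4*\<eta>/(pi+2)\<^sup>2))"
    by (simp add: diff_divide_distrib algebra_simps)
  ultimately have "4 * (k\<^sup>2 * (1/(pi+2)\<^sup>2 - 4*\<eta>/(pi+2)\<^sup>2)) \<le> D" by simp
  then have "C \<le> real n + k\<^sup>2 / 4 - k\<^sup>2 * (1/(pi+2)\<^sup>2 - 4*\<eta>/(pi+2)\<^sup>2) + k/2"
    unfolding D_def by argo
  then show ?thesis unfolding C_def k_def \<eta>_def by (simp add: algebra_simps)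
qed

section \<open>Trivial bound and translation to natural numbers\<close>

text \<open>A new element \<open>x\<close> contributes at most the sums of \<open>x\<close> with the
  elements of \<open>insert x B\<close>.\<close>

lemma card_sums_le_choose:
  fixes B :: "nat set"
  assumes "finite B"
  shows "2 * card ((\<lambda>(a,b). a + b) ` (B \<times> B)) \<le> card B * (card B + 1)"
  using assms
proof (induction B)
  case (insert x B)
  let ?sums = "\<lambda>B. (\<lambda>(a,b). a + b) ` (B \<times> B)"
  have "?sums (insert x B) \<subseteq> ?sums B \<union> (+) x ` insert x B"
    by (auto simp: add.commute)
  then have "card (?sums (insert x B)) \<le> card (?sums B \<union> (+) x ` insert x B)"
    using insert.hyps by (intro card_mono) auto
  also have "\<dots> \<le> card (?sums B) + card ((+) x ` insert x B)"
    by (rule card_Un_le)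
  also have "card ((+) x ` insert x B) \<le> card (insert x B)"
    using insert.hyps by (intro card_image_le) auto
  finally show ?case using insert by simp
qed simp

text \<open>Subtracting 1 from each element makes the elements usable as exponents; sums drop by 2.
  All elements are at least 1 and all sums at least 2, so the truncation in \<open>nat\<close> loses
  nothing.\<close>

lemma sumset_shift:
  assumes "A \<subseteq> {1..int n}"
  obtains B :: "nat set" where "B \<subseteq> {..<n}" "card B = card A"
    "card ((\<lambda>(a,b). a + b) ` (B \<times> B)) = card (sumset A)"
proof
  define f where "f a = nat (a - 1)" for a :: int
  let ?B = "f ` A"
  show "?B \<subseteq> {..<n}" using assms by (force simp: f_def)
  have "inj_on f A"
  proof (rule inj_onI)
    fix a b assume "a \<in> A" "b \<in> A" "f a = f b"
    moreover from this have "a \<ge> 1" "b \<ge> 1" using assms by auto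
    ultimately show "a = b" by (simp add: f_def)
  qed
  then show "card ?B = card A" by (rule card_image)
  have "(\<lambda>(a,b). a + b) ` (?B \<times> ?B) = (\<lambda>m. nat (m - 2)) ` sumset A"
  proof -
    have eq: "f a + f b = nat (a + b - 2)" if "a \<in> A" "b \<in> A" for a b
    proof -
      from that have "a \<ge> 1" "b \<ge> 1" using assms by auto
      then show ?thesis by (simp add: f_def flip: nat_add_distrib)
    qed
    show ?thesis
    proof (intro equalityI subsetI)
      fix m assume "m \<in> (\<lambda>(a,b). a + b) ` (?B \<times> ?B)"
      then obtain a b where "a \<in> A" "b \<in> A" "m = f a + f b" by auto
      then show "m \<in> (\<lambda>m. nat (m - 2)) ` sumset A"
        by (intro image_eqI[of _ _ "a + b"]) (auto simp: eq sumset_def)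
    next
      fix m assume "m \<in> (\<lambda>m. nat (m - 2)) ` sumset A"
      then obtain a b where "a \<in> A" "b \<in> A" "m = nat (a + b - 2)" by (auto simp: sumset_def)
      then show "m \<in> (\<lambda>(a,b). a + b) ` (?B \<times> ?B)"
        by (intro image_eqI[of _ _ "(f a, f b)"]) (simp_all add: eq)
    qed
  qed
  moreover have "inj_on (\<lambda>m. nat (m - 2)) (sumset A)"
  proof -
    have ge2: "m \<ge> 2" if m: "m \<in> sumset A" for m
    proof -
      obtain a b where "m = a + b" "a \<in> A" "b \<in> A" using m by (auto simp: sumset_def)
      moreover from this have "a \<ge> 1" "b \<ge> 1" using assms by auto
      ultimately show ?thesis by simp
    qed
    show ?thesis
    proof (rule inj_onI)
      fix l m assume "l \<in> sumset A" "m \<in> sumset A" and eq: "nat (l - 2) = nat (m - 2)"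
      then have "l \<ge> 2" "m \<ge> 2" by (simp_all only: ge2)
      with eq show "l = m" by simp
    qed
  qed
  ultimately show "card ((\<lambda>(a,b). a + b) ` (?B \<times> ?B)) = card (sumset A)"
    by (simp add: card_image)
qed

section \<open>Conclusion with an error uniform in k\<close>

theorem theorem2:
  "\<exists>e :: nat \<Rightarrow> real. (e \<longlonglongrightarrow> 0) \<and>
     (\<forall>n k. 1 \<le> k \<and> k \<le> n \<longrightarrow>
        real (s k n) \<le> real n + (real k)^2 * (1/4 - 1/(pi + 2)^2 + e n))"
proof -
  \<comment> \<open>The first summand is the error from \<open>card_sums_le\<close>; the second
    absorbs its term k/2 once k >= sqrt n.\<close>
  define e where "e n = 4 * truncation_error (n - 1) / (pi+2)\<^sup>2 + 1 / (2 * sqrt (real n))" for n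
  have "(\<lambda>n. truncation_error (n - 1)) \<longlonglongrightarrow> 0"
    using truncation_error_tendsto by (subst filterlim_sequentially_Suc[symmetric]) simp
  moreover have "(\<lambda>n. 1 / (2 * sqrt (real n))) \<longlonglongrightarrow> 0"
    by (intro tendsto_divide_0[OF tendsto_const] filterlim_at_top_imp_at_infinity
        filterlim_tendsto_pos_mult_at_top[OF tendsto_const]
        filterlim_compose[OF sqrt_at_top filterlim_real_sequentially]) auto
  ultimately have "(\<lambda>n. 4 / (pi+2)\<^sup>2 * truncation_error (n - 1) + 1 / (2 * sqrt (real n)))
      \<longlonglongrightarrow> 4 / (pi+2)\<^sup>2 * 0 + 0"
    by (intro tendsto_add tendsto_mult tendsto_const)
  then have "e \<longlonglongrightarrow> 0" by (simp add: e_def[abs_def])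
  moreover have e0: "e n \<ge> 0" for n
    by (auto simp: e_def truncation_error_def)
  \<comment> \<open>Positivity of the leading coefficient lets the bound \<open>n\<close> suffice
    when k(k+1) <= 2n.\<close>
  have "(2::real)\<^sup>2 < (pi + 2)\<^sup>2"
    by (intro power_strict_mono) auto
  then have c0: "1/4 - 1/(pi+2)\<^sup>2 > 0"
    using divide_less_eq_1[of 4 "(pi+2)\<^sup>2"] by simp
  have main: "real (card (sumset A)) \<le> real n + (real k)\<^sup>2 * (1/4 - 1/(pi + 2)\<^sup>2 + e n)"
    if k: "1 \<le> k" "k \<le> n" and A: "A \<subseteq> {1..int n}" "card A = k" for n k A
  proof -
    obtain B :: "nat set" where B: "B \<subseteq> {..<n}" "card B = k"
        "card ((\<lambda>(a,b). a + b) ` (B \<times> B)) = card (sumset A)"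
      using sumset_shift[OF A(1)] A(2) by metis
    have fin: "finite B" using B(1) finite_subset by blast
    have two: "2 * card (sumset A) \<le> k * (k + 1)"
      using card_sums_le_choose[OF fin] B by simp
    show ?thesis
    proof (cases "k * (k + 1) \<le> 2 * n")
      case True
      with two have "real (card (sumset A)) \<le> real n" by simp
      moreover have "(real k)\<^sup>2 * (1/4 - 1/(pi + 2)\<^sup>2 + e n) \<ge> 0"
        using c0 e0[of n] by (intro mult_nonneg_nonneg) auto
      ultimately show ?thesis by linarith
    next
      case False
      have "k \<noteq> 1" using False k by auto
      then have n: "n \<ge> 2" using k by simp
      \<comment> \<open>With k(k+1) > 2n this yields k^2 >= n.\<close>
      have "k * (k + 1) \<le> k * (2 * k)" using k by (intro mult_left_mono) auto
      also have "\<dots> = 2 * (k * k)" by simp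
      finally have "n \<le> k * k" using False by linarith
      then have "real n \<le> (real k)\<^sup>2" by (simp add: power2_eq_square flip: of_nat_mult)
      then have sk: "sqrt (real n) \<le> real k" by (simp add: real_le_lsqrt)
      have sp: "sqrt (real n) > 0" using n by simp
      have "real k / 2 = real k * sqrt (real n) / (2 * sqrt (real n))" using sp by simp
      also have "\<dots> \<le> real k * real k / (2 * sqrt (real n))"
        using sk sp by (intro divide_right_mono mult_left_mono) auto
      finally have "real k / 2 \<le> (real k)\<^sup>2 * (1 / (2 * sqrt (real n)))"
        by (simp add: power2_eq_square)
      with card_sums_le[OF B(1) n] show ?thesis
        unfolding B e_def by (simp add: algebra_simps)
    qed
  qed
  have "real (s k n) \<le> real n + (real k)\<^sup>2 * (1/4 - 1/(pi + 2)\<^sup>2 + e n)"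
    if k: "1 \<le> k" "k \<le> n" for n k
  proof -
    let ?X = "{card (sumset A) | A. A \<subseteq> {1..int n} \<and> card A = k}"
    have "?X \<subseteq> (\<lambda>A. card (sumset A)) ` Pow {1..int n}" by auto
    then have "finite ?X" by (rule finite_subset) simp
    \<comment> \<open>The hypothesis k <= n supplies a set of size \<open>k\<close>, so the maximum
      is over a nonempty set and is attained.\<close>
    moreover have "card {1..int k} = k" "{1..int k} \<subseteq> {1..int n}" using k by auto
    then have "?X \<noteq> {}" by blast
    ultimately have "s k n \<in> ?X" unfolding s_def by (rule Max_in)
    then show ?thesis using main[OF k] by auto
  qed
  ultimately show ?thesis by blast
qed

end
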